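(* Let $L_N=\mathbb{N}=\{0,1,2,\dots\}$. There are infinitely many finite consequence operators on $L_N$ that cannot be generated by a finite logic-system on $L_N$.
   Context: Let $L$ be a nonempty set (a "language"); here $L_N$ is a language whose members are symbols denoting the natural numbers, identified with $\mathbb{N}$. Write $\mathcal{P}(L)$ for the power set of $L$ and $\mathcal{F}(X)$ for the set of finite subsets of $X$; $\subset$ allows equality. A general consequence operator on $L$ is a map $C\colon\mathcal{P}(L)\to\mathcal{P}(L)$ such that for all $X,Y\in\mathcal{P}(L)$: (i) $X\subset C(X)=C(C(X))\subset L$; (ii) if $X\subset Y$ then $C(X)\subset C(Y)$. It is finite if moreover (iii) $C(X)=\bigcup\{C(A)\mid A\in\mathcal{F}(X)\}$ for all $X$. A general logic-system on $L$ is a nonempty (finite or infinite) set $\mathbf{RI}$ of relations (rules of inference), each of which is an $n$-ary relation, i.e. a subset (possibly empty) of $L^n$, for some integer $n\ge1$ depending on the relation (with $L^1$ identified with $L$). It is a finite logic-system if the set $\mathbf{RI}$ consists of finitely many relations; the individual relations may be infinite sets. An $\mathbf{RI}$-deduction from $X\subset L$ is a finite sequence $b_1,\dots,b_m$ ($m\ge1$) of members of $L$ such that for each $i$ either $b_i\in X$, or $b_i$ belongs to a unary relation in $\mathbf{RI}$, or there are $k\ge1$, a $(k+1)$-ary relation $R\in\mathbf{RI}$ and $(y_1,\dots,y_{k+1})\in R$ such that $y_{k+1}=b_i$ and each of $y_1,\dots,y_k$ lies in $X$, or in a unary relation of $\mathbf{RI}$, or in $\{b_1,\dots,b_{i-1}\}$.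 The consequence operator generated (defined) by $\mathbf{RI}$ sends $X$ to the set of all $x\in L$ for which there is an $\mathbf{RI}$-deduction from $X$ whose last term is $x$; it is a finite consequence operator. *)

theory Defs
  imports Main
begin

text \<open>
  The language is the whole (automatically nonempty) type \<open>'a\<close>, so the power set of the language
  is the type \<open>'a set\<close>, and the closure conditions "is a subset of the language" hold by typing.
\<close>

definition consequence_operator :: "('a set \<Rightarrow> 'a set) \<Rightarrow> bool" where
  "consequence_operator C \<longleftrightarrow>
     (\<forall>X. X \<subseteq> C X \<and> C X = C (C X)) \<and>
     (\<forall>X Y. X \<subseteq> Y \<longrightarrow> C X \<subseteq> C Y)"

definition finite_consequence_operator :: "('a set \<Rightarrow> 'a set) \<Rightarrow> bool" where
  "finite_consequence_operator C \<longleftrightarrow>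
     consequence_operator C \<and> (\<forall>X. C X = \<Union>{C A | A. finite A \<and> A \<subseteq> X})"

text \<open>An \<open>n\<close>-tuple over the language is a list of length \<open>n\<close>.\<close>

definition nary_relation :: "nat \<Rightarrow> 'a list set \<Rightarrow> bool" where
  "nary_relation n R \<longleftrightarrow> (\<forall>t\<in>R. length t = n)"

definition logic_system :: "'a list set set \<Rightarrow> bool" where
  "logic_system RI \<longleftrightarrow> RI \<noteq> {} \<and> (\<forall>R\<in>RI. \<exists>n\<ge>1. nary_relation n R)"

text \<open>Only the number of relations is bounded; each of them may be an infinite set.\<close>

definition finite_logic_system :: "'a list set set \<Rightarrow> bool" where
  "finite_logic_system RI \<longleftrightarrow> logic_system RI \<and> finite RI"

text \<open>
  The elements of the unary relations. In a logic system all tuples of a relation have the same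
  length, so a relation containing \<open>[x]\<close> is unary.
\<close>

definition axioms_of :: "'a list set set \<Rightarrow> 'a set" where
  "axioms_of RI = {x. \<exists>R\<in>RI. [x] \<in> R}"

text \<open>
  A tuple of a relation of arity \<open>k + 1\<close> with \<open>k \<ge> 1\<close> is written \<open>ys @ [b]\<close>, where the nonempty
  list \<open>ys\<close> holds the premises; \<open>take i bs\<close> consists of the members of \<open>bs\<close> before position \<open>i\<close>
  (positions count from 0).
\<close>

definition deduction :: "'a list set set \<Rightarrow> 'a set \<Rightarrow> 'a list \<Rightarrow> bool" where
  "deduction RI X bs \<longleftrightarrow> bs \<noteq> [] \<and>
     (\<forall>i<length bs.
        bs ! i \<in> X \<or>
        bs ! i \<in> axioms_of RI \<or>
        (\<exists>R\<in>RI. \<exists>ys. ys \<noteq> [] \<and> ys @ [bs ! i] \<in> R \<and>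
           set ys \<subseteq> X \<union> axioms_of RI \<union> set (take i bs)))"

definition generated_operator :: "'a list set set \<Rightarrow> 'a set \<Rightarrow> 'a set" where
  "generated_operator RI X = {x. \<exists>bs. deduction RI X bs \<and> last bs = x}"

end

theory Submission imports Defs begin

text \<open>
  The rules of a finite logic-system have at most \<open>M\<close> premises for some \<open>M\<close>, so a set that contains
  the consequences of all its subsets with at most \<open>M\<close> elements is closed under deduction. The
  operator that collapses \<open>X\<close> to the whole language as soon as \<open>X\<close> includes an interval \<open>{n..2 * n}\<close>
  with \<open>n \<ge> k\<close> violates this for every \<open>M\<close>: these intervals are pairwise incomparable, so removing
  any point from one of them leaves a closed set. Different \<open>k\<close> give different operators.
\<close>

lemma finite_logic_system_bounded_arity:
  assumes "finite_logic_system RI"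
  obtains M where "\<And>R t. R \<in> RI \<Longrightarrow> t \<in> R \<Longrightarrow> length t \<le> Suc M"
proof -
  from assms obtain a where a: "\<And>R t. R \<in> RI \<Longrightarrow> t \<in> R \<Longrightarrow> length t = a R"
    unfolding finite_logic_system_def logic_system_def nary_relation_def by metis
  show thesis
  proof (rule that)
    fix R t assume "R \<in> RI" "t \<in> R"
    \<comment> \<open>Finiteness of \<open>RI\<close> enters here: the arities of its relations have
      a maximum.\<close>
    moreover have "a R \<le> Max (a ` RI)"
      using assms \<open>R \<in> RI\<close> by (simp add: finite_logic_system_def)
    ultimately show "length t \<le> Suc (Max (a ` RI))"
      using a by (simp add: le_SucI)
  qed
qed

lemma axioms_subset_generated_operator: "axioms_of RI \<subseteq> generated_operator RI X"
proof
  fix x assume "x \<in> axioms_of RI"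
  then have "deduction RI X [x]" by (simp add: deduction_def)
  then show "x \<in> generated_operator RI X"
    unfolding generated_operator_def by force
qed

lemma rule_in_generated_operator:
  assumes "R \<in> RI" "ys @ [b] \<in> R" "ys \<noteq> []"
  shows "b \<in> generated_operator RI (set ys)"
proof -
  have "deduction RI (set ys) [b]"
    using assms by (auto simp: deduction_def)
  then show ?thesis unfolding generated_operator_def by force
qed

text \<open>Induction along a deduction: the premises of each rule application already lie in
  \<open>X\<close> and form a set of at most \<open>M\<close> elements, from which the conclusion
  follows by a one-step deduction, so \<open>small\<close> applies.\<close>

lemma generated_operator_closed:
  assumes arity: "\<And>R t. R \<in> RI \<Longrightarrow> t \<in> R \<Longrightarrow> length t \<le> Suc M"
    and small: "\<And>Y. Y \<subseteq> X \<Longrightarrow> finite Y \<Longrightarrow> card Y \<le> M \<Longrightarrow> generated_operator RI Y \<subseteq> X"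
  shows "generated_operator RI X \<subseteq> X"
proof
  \<comment> \<open>Axioms are consequences of the empty set, whose cardinality is within any bound
    \<open>M\<close>.\<close>
  have ax: "axioms_of RI \<subseteq> X"
    using axioms_subset_generated_operator[of RI "{}"] small[of "{}"] by simp
  fix x assume "x \<in> generated_operator RI X"
  then obtain bs where bs: "deduction RI X bs" "last bs = x"
    by (auto simp: generated_operator_def)
  have "i < length bs \<Longrightarrow> bs ! i \<in> X" for i
  proof (induction i rule: less_induct)
    case (less i)
    then have prev: "set (take i bs) \<subseteq> X"
      by (auto simp: in_set_conv_nth)
    from bs(1) less.prems consider "bs ! i \<in> X" | "bs ! i \<in> axioms_of RI"
      | R ys where "R \<in> RI" "ys \<noteq> []" "ys @ [bs ! i] \<in> R"
          "set ys \<subseteq> X \<union> axioms_of RI \<union> set (take i bs)"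
      unfolding deduction_def by blast
    then show ?case
    proof cases
      case 3
      have "card (set ys) \<le> M"
        using arity[OF 3(1,3)] card_length[of ys] by simp
      then have "generated_operator RI (set ys) \<subseteq> X"
        using 3(4) ax prev by (intro small) auto
      then show ?thesis using rule_in_generated_operator[OF 3(1,3,2)] by blast
    qed (use ax in auto)
  qed
  then show "x \<in> X" using bs by (auto simp: deduction_def last_conv_nth)
qed

definition collapse :: "nat \<Rightarrow> nat set \<Rightarrow> nat set" where
  "collapse k X = (if \<exists>n\<ge>k. {n..2 * n} \<subseteq> X then UNIV else X)"

lemma collapse_eq_UNIV: "k \<le> n \<Longrightarrow> {n..2 * n} \<subseteq> X \<Longrightarrow> collapse k X = UNIV"
  by (auto simp: collapse_def)

text \<open>Finiteness holds because a collapse is already caused by one finite interval, and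
  without a collapse the singletons of members of \<open>X\<close> suffice.\<close>

lemma finite_consequence_operator_collapse: "finite_consequence_operator (collapse k)"
proof -
  have mono: "collapse k X \<subseteq> collapse k Y" if "X \<subseteq> Y" for X Y
    using that order_trans[OF _ that] unfolding collapse_def by (smt (verit) subset_UNIV)
  have ext: "X \<subseteq> collapse k X" for X
    by (simp add: collapse_def)
  have idem: "collapse k X = collapse k (collapse k X)" for X
    by (auto simp: collapse_def)
  have "collapse k X \<subseteq> \<Union>{collapse k A | A. finite A \<and> A \<subseteq> X}" for X
  proof (cases "\<exists>n\<ge>k. {n..2 * n} \<subseteq> X")
    case True
    then obtain n where "n \<ge> k" "{n..2 * n} \<subseteq> X" by blast
    then have "UNIV \<in> {collapse k A | A. finite A \<and> A \<subseteq> X}"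
      using collapse_eq_UNIV[of k n "{n..2 * n}"]
      by (metis (mono_tags, lifting) finite_atLeastAtMost mem_Collect_eq order_refl)
    then show ?thesis by blast
  next
    case False
    show ?thesis
    proof
      fix x assume "x \<in> collapse k X"
      then have "x \<in> X" using False by (simp add: collapse_def)
      moreover have "x \<in> collapse k {x}" using ext by blast
      ultimately show "x \<in> \<Union>{collapse k A | A. finite A \<and> A \<subseteq> X}"
        by (intro UnionI[of "collapse k {x}"]) auto
    qed
  qed
  moreover have "\<Union>{collapse k A | A. finite A \<and> A \<subseteq> X} \<subseteq> collapse k X" for X
    by (rule Union_least) (auto dest: subsetD[OF mono])
  ultimately have "\<forall>X. collapse k X = \<Union>{collapse k A | A. finite A \<and> A \<subseteq> X}"
    by (intro allI equalityI)
  then show ?thesis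
    unfolding finite_consequence_operator_def consequence_operator_def
    by (intro conjI allI impI) (rule ext idem | erule mono | erule spec)+
qed

text \<open>The alternative \<open>Y \<noteq> {n..2 * n}\<close> serves non-generation,
  \<open>n < k\<close> serves injectivity.\<close>

lemma collapse_interval_subset:
  assumes "Y \<subseteq> {n..2 * n}" and "Y \<noteq> {n..2 * n} \<or> n < k"
  shows "collapse k Y = Y"
proof -
  have False if m: "k \<le> m" "{m..2 * m} \<subseteq> Y" for m
  proof -
    have "{m..2 * m} \<subseteq> {n..2 * n}" using m assms by blast
    \<comment> \<open>The left endpoints give \<open>n \<le> m\<close>, the right endpoints
      \<open>2 * m \<le> 2 * n\<close>.\<close>
    then have "m = n" by simp
    then show False using m assms by auto
  qed
  then show ?thesis by (auto simp: collapse_def)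
qed

lemma collapse_not_finitely_generated:
  assumes "finite_logic_system RI"
  shows "generated_operator RI \<noteq> collapse k"
proof
  assume gen: "generated_operator RI = collapse k"
  obtain M where arity: "\<And>R t. R \<in> RI \<Longrightarrow> t \<in> R \<Longrightarrow> length t \<le> Suc M"
    using finite_logic_system_bounded_arity[OF assms] by blast
  \<comment> \<open>\<open>n \<ge> k\<close> makes the full interval collapse;
    \<open>n \<ge> M\<close> gives it \<open>n + 1 > M\<close> elements, so no \<open>Y\<close> with
    at most \<open>M\<close> elements exhausts it.\<close>
  define n where "n = max k M"
  have "generated_operator RI {n..2 * n} \<subseteq> {n..2 * n}"
  proof (rule generated_operator_closed[OF arity])
    fix Y assume Y: "Y \<subseteq> {n..2 * n}" "card Y \<le> M"
    then have "Y \<noteq> {n..2 * n}" by (auto simp: n_def)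
    then show "generated_operator RI Y \<subseteq> {n..2 * n}"
      using Y gen collapse_interval_subset by metis
  qed
  moreover have "generated_operator RI {n..2 * n} = UNIV"
    unfolding gen by (rule collapse_eq_UNIV[of _ n]) (auto simp: n_def)
  ultimately show False
    using infinite_UNIV_nat finite_subset finite_atLeastAtMost by metis
qed

text \<open>For \<open>j < k\<close>, the interval \<open>{j..2 * j}\<close> separates the
  operators: it collapses under the first and is fixed by the second.\<close>

lemma inj_collapse: "inj collapse"
proof (rule linorder_injI)
  fix j k :: nat assume "j < k"
  have "collapse j {j..2 * j} = UNIV" by (rule collapse_eq_UNIV) auto
  moreover have "collapse k {j..2 * j} = {j..2 * j}"
    using \<open>j < k\<close> by (intro collapse_interval_subset[of _ j]) auto
  ultimately show "collapse j \<noteq> collapse k"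
    using infinite_UNIV_nat finite_atLeastAtMost by metis
qed

theorem corollary2p2p1:
  "infinite {C :: nat set \<Rightarrow> nat set.
     finite_consequence_operator C \<and>
     \<not> (\<exists>RI. finite_logic_system RI \<and> generated_operator RI = C)}"
proof (rule infinite_super)
  show "infinite (range collapse)"
    using inj_collapse by (simp add: finite_image_iff)
qed (use finite_consequence_operator_collapse collapse_not_finitely_generated in blast)

end
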